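(* Let $\theta,\lambda>0$. Let $\mathbf X=(X_1,X_2,\dots)$ be i.i.d. positive random variables with pdf $p_X$ differentiable on $(0,\infty)$, cdf $F_X$ and score function $\rho_X=p_X'/p_X$, let $M$ be an $\mathbb N$-valued random variable with finite second moment, independent of $\mathbf X$, with probability generating function $G_M(u)=\mathbb E u^M$, and let $W=W_1(M,\mathbf X)=\max\{X_1,\dots,X_M\}$. Then $$d_{TV}\left(PE(\theta,\lambda),\mathcal L(W)\right)\le\frac4\lambda\left(\mathbb E\left|\theta\lambda e^{-\lambda W}-\frac{(G_M''\circ F_X)(W)}{(G_M'\circ F_X)(W)}\,p_X(W)\right|+\mathbb E\left|-\lambda-\rho_X(W)\right|\right).$$ If $M$ is a zero-truncated Poisson$(\theta_m)$ random variable, then this bound reduces to $$d_{TV}\left(PE(\theta,\lambda),\mathcal L(W)\right)\le\frac4\lambda\left(\mathbb E\left|\theta\lambda e^{-\lambda W}-\theta_m p_X(W)\right|+\mathbb E\left|-\lambda-\rho_X(W)\right|\right).$$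
   Context: $\mathbb N=\{1,2,\dots\}$; convention $0/0=0$. $PE(\theta,\lambda)$ is the Poisson-exponential distribution, with pdf $\frac{\theta\lambda e^{-\lambda w-\theta e^{-\lambda w}}}{1-e^{-\theta}}$, $w>0$; it is the law of the maximum of $N$ i.i.d. exponential variables of rate $\lambda$ with $N$ an independent zero-truncated Poisson$(\theta)$ variable. A zero-truncated Poisson$(\theta)$ variable is a Poisson$(\theta)$ variable conditioned to be at least $1$. $d_{TV}(P,Q)=\sup_{A}|P(A)-Q(A)|$ over Borel sets $A$. $\mathcal L(W)$ is the law of $W$. *)

theory Defs
  imports "HOL-Probability.Probability"
begin

text \<open>For finite measures this is a supremum over a nonempty set of reals that is bounded above.\<close>

definition dTV :: "real measure \<Rightarrow> real measure \<Rightarrow> real" where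
  "dTV P Q = (SUP A\<in>sets borel. \<bar>measure P A - measure Q A\<bar>)"

definition poisson_exponential :: "real \<Rightarrow> real \<Rightarrow> real measure" where
  "poisson_exponential \<theta> l = density lborel
     (\<lambda>w. ennreal (if 0 < w then \<theta> * l * exp (- l * w - \<theta> * exp (- l * w)) / (1 - exp (- \<theta>)) else 0))"

definition zt_poisson_pmf :: "real \<Rightarrow> nat pmf" where
  "zt_poisson_pmf \<theta> = cond_pmf (poisson_pmf \<theta>) {1..}"

text \<open>
  Only the values on \<open>[0, 1]\<close> are meaningful in general: for \<open>u > 1\<close> the integrand may fail to be
  integrable, and the Bochner integral is then \<open>0\<close>.  If \<open>M\<close> has radius of convergence 1, the two-sided
  \<^const>\<open>deriv\<close> of this function is therefore not the one-sided derivative at \<open>u = 1\<close>.  In the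
  theorem the derivatives are evaluated at \<open>F (W)\<close>, which lies in the open interval \<open>(0, 1)\<close> almost
  surely because \<open>F\<close> is the distribution function of a continuous law.
\<close>

definition pgf :: "'a measure \<Rightarrow> ('a \<Rightarrow> nat) \<Rightarrow> real \<Rightarrow> real" where
  "pgf \<mu> M u = (\<integral>\<omega>. u ^ M \<omega> \<partial>\<mu>)"

definition score :: "(real \<Rightarrow> real) \<Rightarrow> real \<Rightarrow> real" where
  "score p x = deriv p x / p x"

definition random_max :: "('a \<Rightarrow> nat) \<Rightarrow> (nat \<Rightarrow> 'a \<Rightarrow> real) \<Rightarrow> 'a \<Rightarrow> real" where
  "random_max M X \<omega> = Max ((\<lambda>i. X i \<omega>) ` {1..M \<omega>})"

text \<open>
  Independence of two random elements as independence of the generated sigma-algebras;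
  the library's \<^const>\<open>prob_space.indep_var\<close> requires both to take values in the same type.
\<close>

definition indep_elements ::
    "'a measure \<Rightarrow> 'b measure \<Rightarrow> ('a \<Rightarrow> 'b) \<Rightarrow> 'c measure \<Rightarrow> ('a \<Rightarrow> 'c) \<Rightarrow> bool" where
  "indep_elements \<mu> S Y T Z \<longleftrightarrow>
     Y \<in> measurable \<mu> S \<and> Z \<in> measurable \<mu> T \<and>
     prob_space.indep_set \<mu> (sets (vimage_algebra (space \<mu>) Y S)) (sets (vimage_algebra (space \<mu>) Z T))"

end

theory Submission
  imports Defs
begin

text \<open>
  The law of \<open>W\<close> has cdf \<open>G \<circ> F\<close> and density \<open>f = p \<cdot> (G' \<circ> F)\<close>, so the quantity inside the two
  expectations is the difference of the scores of the target density \<open>q\<close> and of \<open>f\<close>.  With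
  \<open>r = f / q\<close> this difference integrates to \<open>E \<bar>s\<^sub>q(W) - s\<^sub>f(W)\<bar> = \<integral> \<bar>r'\<bar> q\<close>, while the total
  variation distance is at most \<open>\<integral> \<bar>r - 1\<bar> q\<close>.  The two are compared by an \<open>L\<^sup>1\<close> Poincare inequality,
  whose weight \<open>Q (1 - Q)\<close> is at most \<open>q / \<lambda>\<close> for the Poisson-exponential cdf \<open>Q\<close>; this gives the
  bound with \<open>2 / \<lambda>\<close> in place of \<open>4 / \<lambda>\<close>.

  Although \<open>p'\<close> need not be locally integrable, \<open>r\<close> can be recovered from \<open>r'\<close> by the Henstock-Kurzweil
  fundamental theorem of calculus, because \<open>f\<close> is differentiable at every point of \<open>(0, \<infinity>)\<close>.  Where \<open>p\<close> is positive,
  \<open>F\<close> lies in the open interval \<open>(0, 1)\<close> and the chain rule gives \<open>f'\<close>; where \<open>p\<close> vanishes, so does \<open>p'\<close>,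
  and \<open>f' = 0\<close> because \<open>G'\<close> is bounded on \<open>[0, 1]\<close>.
\<close>

section \<open>An \<open>L\<^sup>1\<close> Poincare inequality\<close>

text \<open>The derivative is the pointwise limit of difference quotients with step
  \<open>inverse (real (Suc n))\<close>, each Borel because \<open>r\<close> is. No regularity of
  \<open>r'\<close> enters.\<close>

lemma borel_measurable_derivative:
  fixes r r' :: "real \<Rightarrow> real"
  assumes [measurable]: "r \<in> borel_measurable borel" "S \<in> sets borel"
    and deriv: "\<And>x. x \<in> S \<Longrightarrow> (r has_real_derivative r' x) (at x)"
  shows "(\<lambda>x. if x \<in> S then r' x else 0) \<in> borel_measurable borel"
proof (rule borel_measurable_LIMSEQ_real)
  fix x :: real
  show "(\<lambda>n. if x \<in> S then (r (x + inverse (real (Suc n))) - r x) / inverse (real (Suc n)) else 0)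
      \<longlonglongrightarrow> (if x \<in> S then r' x else 0)"
  proof (cases "x \<in> S")
    case True
    have "filterlim (\<lambda>n. inverse (real (Suc n))) (at 0) sequentially"
      using LIMSEQ_inverse_real_of_nat by (auto simp: filterlim_at)
    then show ?thesis
      using True deriv[OF True] by (auto simp: DERIV_def elim: filterlim_compose)
  qed simp
qed measurable

text \<open>If the integral is infinite there is nothing to show. Otherwise \<open>r'\<close> is
  Lebesgue integrable on the interval, its Lebesgue and gauge integrals agree, and the gauge form of
  the fundamental theorem evaluates the latter without continuity of \<open>r'\<close>.\<close>

lemma abs_diff_le_nn_integral_derivative:
  fixes r r' :: "real \<Rightarrow> real"
  assumes "a \<le> b"
    and deriv: "\<And>x. a \<le> x \<Longrightarrow> x \<le> b \<Longrightarrow> (r has_real_derivative r' x) (at x)"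
    and [measurable]: "(\<lambda>x. indicator {a..b} x * r' x) \<in> borel_measurable borel"
  shows "ennreal \<bar>r b - r a\<bar> \<le> (\<integral>\<^sup>+x. ennreal \<bar>indicator {a..b} x * r' x\<bar> \<partial>lborel)"
proof (cases "(\<integral>\<^sup>+x. ennreal \<bar>indicator {a..b} x * r' x\<bar> \<partial>lborel) = \<infinity>")
  case False
  have int: "set_integrable lborel {a..b} r'"
    using False by (auto simp: set_integrable_def integrable_iff_bounded top.not_eq_extremum)
  have "(r' has_integral (r b - r a)) {a..b}"
    using assms(1) deriv
    by (intro fundamental_theorem_of_calculus)
       (auto simp: has_real_derivative_iff_has_vector_derivative has_vector_derivative_at_within)
  then have "r b - r a = (LINT x:{a..b}|lborel. r' x)"
    using set_borel_integral_eq_integral(2)[OF int] by (simp add: integral_unique)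
  also have "ennreal (norm \<dots>) \<le> (\<integral>\<^sup>+x. ennreal (norm (indicator {a..b} x *\<^sub>R r' x)) \<partial>lborel)"
    unfolding set_lebesgue_integral_def
    using int by (intro integral_norm_bound_ennreal) (simp add: set_integrable_def)
  finally show ?thesis by simp
qed simp

text \<open>Writing \<open>r y - r x\<close> as an integral of \<open>r'\<close> over \<open>t\<close> and exchanging the order of integration
  leaves at \<open>t\<close> the mass of the pairs separated by \<open>t\<close>.\<close>

lemma nn_integral_abs_diff_expectation_le:
  fixes r r' :: "real \<Rightarrow> real"
  assumes "prob_space N" and sets[measurable_cong]: "sets N = sets borel"
    and pos: "AE x in N. 0 < x"
    and r: "integrable N r"
    and deriv: "\<And>x. 0 < x \<Longrightarrow> (r has_real_derivative r' x) (at x)"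
  shows "(\<integral>\<^sup>+y. ennreal \<bar>r y - (\<integral>x. r x \<partial>N)\<bar> \<partial>N)
    \<le> 2 * (\<integral>\<^sup>+t. (if 0 < t then ennreal \<bar>r' t\<bar> * (emeasure N {..t} * emeasure N {t..}) else 0) \<partial>lborel)"
proof -
  interpret prob_space N by fact
  have rb[measurable]: "r \<in> borel_measurable borel"
    using borel_measurable_integrable[OF r] sets by (simp cong: measurable_cong_sets)
  define d where "d = (\<lambda>x. if x \<in> {0<..} then r' x else 0)"
  have [measurable]: "d \<in> borel_measurable borel"
    unfolding d_def by (rule borel_measurable_derivative[OF rb]) (auto intro: deriv)
  interpret LN: pair_sigma_finite lborel N ..
  \<comment> \<open>\<open>J x y\<close> vanishes unless \<open>x \<le> y\<close>, so
    \<open>J x y t + J y x t\<close> covers both orders of a pair; the doubling on the diagonal does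
    no harm in an upper bound.\<close>
  define J where "J x y t = (if x \<le> t \<and> t \<le> y then ennreal \<bar>d t\<bar> else 0)" for x y t :: real
  have sep: "ennreal \<bar>r y - r x\<bar> \<le> (\<integral>\<^sup>+t. J x y t \<partial>lborel)" if "0 < x" "x \<le> y" for x y
  proof -
    have eq: "indicator {x..y} t * r' t = indicator {x..y} t * d t" for t
      using that by (auto simp: d_def indicator_def)
    have "ennreal \<bar>r y - r x\<bar> \<le> (\<integral>\<^sup>+t. ennreal \<bar>indicator {x..y} t * r' t\<bar> \<partial>lborel)"
      by (rule abs_diff_le_nn_integral_derivative) (use that deriv in \<open>auto simp: eq\<close>)
    also have "\<dots> = (\<integral>\<^sup>+t. J x y t \<partial>lborel)"
      unfolding eq by (intro nn_integral_cong) (auto simp: J_def indicator_def)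
    finally show ?thesis .
  qed
  have sep2: "ennreal \<bar>r y - r x\<bar> \<le> (\<integral>\<^sup>+t. J x y t + J y x t \<partial>lborel)" if "0 < x" "0 < y" for x y
  proof (cases "x \<le> y")
    case True
    show ?thesis
      by (rule order_trans[OF sep[OF that(1) True]]) (intro nn_integral_mono, simp)
  next
    case False
    then have "ennreal \<bar>r x - r y\<bar> \<le> (\<integral>\<^sup>+t. J y x t \<partial>lborel)" using sep[of y x] that by simp
    also have "\<dots> \<le> (\<integral>\<^sup>+t. J x y t + J y x t \<partial>lborel)" by (intro nn_integral_mono) simp
    finally show ?thesis by (simp add: abs_minus_commute)
  qed
  \<comment> \<open>Under a probability measure the deviation from the mean is an average of the
    differences \<open>r y - r x\<close>.\<close>
  have 1: "ennreal \<bar>r y - (\<integral>x. r x \<partial>N)\<bar> \<le> (\<integral>\<^sup>+x. ennreal \<bar>r y - r x\<bar> \<partial>N)" for y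
  proof -
    have "r y - (\<integral>x. r x \<partial>N) = (\<integral>x. r y - r x \<partial>N)"
      using r by (simp add: prob_space)
    then show ?thesis
      using integral_norm_bound_ennreal[of N "\<lambda>x. r y - r x"] r
      by (simp del: Bochner_Integration.integral_diff)
  qed
  have "(\<integral>\<^sup>+y. ennreal \<bar>r y - (\<integral>x. r x \<partial>N)\<bar> \<partial>N) \<le> (\<integral>\<^sup>+y. \<integral>\<^sup>+x. ennreal \<bar>r y - r x\<bar> \<partial>N \<partial>N)"
    by (intro nn_integral_mono 1)
  also have "\<dots> \<le> (\<integral>\<^sup>+y. \<integral>\<^sup>+x. (\<integral>\<^sup>+t. J x y t + J y x t \<partial>lborel) \<partial>N \<partial>N)"
  proof (rule nn_integral_mono_AE)
    show "AE y in N. (\<integral>\<^sup>+x. ennreal \<bar>r y - r x\<bar> \<partial>N) \<le> (\<integral>\<^sup>+x. (\<integral>\<^sup>+t. J x y t + J y x t \<partial>lborel) \<partial>N)"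
      using pos
    proof eventually_elim
      case (elim y)
      show ?case
        using pos by (intro nn_integral_mono_AE, eventually_elim) (rule sep2[OF _ elim])
    qed
  qed
  also have "\<dots> = (\<integral>\<^sup>+y. \<integral>\<^sup>+t. (\<integral>\<^sup>+x. J x y t + J y x t \<partial>N) \<partial>lborel \<partial>N)"
    unfolding J_def by (intro nn_integral_cong LN.Fubini') measurable
  also have "\<dots> = (\<integral>\<^sup>+t. \<integral>\<^sup>+y. (\<integral>\<^sup>+x. J x y t + J y x t \<partial>N) \<partial>N \<partial>lborel)"
    unfolding J_def by (intro LN.Fubini') measurable
  \<comment> \<open>For fixed \<open>t\<close> the double integral factors into the two tail masses;
    the two orders of the pair contribute equally, which is the source of the factor 2.\<close>
  also have "\<dots> = (\<integral>\<^sup>+t. 2 * (ennreal \<bar>d t\<bar> * (emeasure N {..t} * emeasure N {t..})) \<partial>lborel)"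
  proof (intro nn_integral_cong)
    fix t :: real
    have "(\<integral>\<^sup>+y. (\<integral>\<^sup>+x. J x y t + J y x t \<partial>N) \<partial>N)
      = (\<integral>\<^sup>+y. (\<integral>\<^sup>+x. ennreal \<bar>d t\<bar> * (indicator {..t} x * indicator {t..} y)
           + ennreal \<bar>d t\<bar> * (indicator {..t} y * indicator {t..} x) \<partial>N) \<partial>N)"
      by (intro nn_integral_cong) (auto simp: J_def indicator_def)
    also have "\<dots> = 2 * (ennreal \<bar>d t\<bar> * (emeasure N {..t} * emeasure N {t..}))"
      by (simp add: nn_integral_add nn_integral_cmult nn_integral_multc sets mult_ac mult_2)
    finally show "(\<integral>\<^sup>+y. (\<integral>\<^sup>+x. J x y t + J y x t \<partial>N) \<partial>N) =
      2 * (ennreal \<bar>d t\<bar> * (emeasure N {..t} * emeasure N {t..}))" .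
  qed
  also have "\<dots> = 2 * (\<integral>\<^sup>+t. ennreal \<bar>d t\<bar> * (emeasure N {..t} * emeasure N {t..}) \<partial>lborel)"
  proof (rule nn_integral_cmult)
    have "(\<lambda>t. \<integral>\<^sup>+x. (if x \<le> t then 1 else 0) \<partial>N) \<in> borel_measurable lborel"
      "(\<lambda>t. \<integral>\<^sup>+x. (if t \<le> x then 1 else 0) \<partial>N) \<in> borel_measurable lborel"
      by measurable
    moreover have "(\<integral>\<^sup>+x. (if x \<le> t then 1 else 0) \<partial>N) = emeasure N {..t}"
      "(\<integral>\<^sup>+x. (if t \<le> x then 1 else 0) \<partial>N) = emeasure N {t..}" for t
      by (auto simp: sets simp flip: nn_integral_indicator intro!: nn_integral_cong)
    ultimately have [measurable]: "(\<lambda>t. emeasure N {..t}) \<in> borel_measurable lborel"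
      "(\<lambda>t. emeasure N {t..}) \<in> borel_measurable lborel"
      by simp_all
    show "(\<lambda>t. ennreal \<bar>d t\<bar> * (emeasure N {..t} * emeasure N {t..})) \<in> borel_measurable lborel"
      by measurable
  qed
  also have "(\<integral>\<^sup>+t. ennreal \<bar>d t\<bar> * (emeasure N {..t} * emeasure N {t..}) \<partial>lborel)
    = (\<integral>\<^sup>+t. (if 0 < t then ennreal \<bar>r' t\<bar> * (emeasure N {..t} * emeasure N {t..}) else 0) \<partial>lborel)"
    by (intro nn_integral_cong) (simp add: d_def)
  finally show ?thesis .
qed

text \<open>For each Borel set the difference is the integral of \<open>1 - r\<close> over it.
  Splitting by the sign of \<open>r - 1\<close> would halve the bound when \<open>r\<close> has mean
  1; the cruder form suffices.\<close>

lemma dTV_density_le: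
  fixes r :: "real \<Rightarrow> real"
  assumes N: "prob_space N" and sets[measurable_cong]: "sets N = sets borel"
    and r: "integrable N r" and nonneg: "\<And>x. 0 \<le> r x"
  shows "ennreal (dTV N (density N (\<lambda>x. ennreal (r x)))) \<le> (\<integral>\<^sup>+x. ennreal \<bar>r x - 1\<bar> \<partial>N)"
proof -
  interpret prob_space N by fact
  define B where "B = (\<integral>x. \<bar>r x - 1\<bar> \<partial>N)"
  have B: "(\<integral>\<^sup>+x. ennreal \<bar>r x - 1\<bar> \<partial>N) = ennreal B"
    unfolding B_def using r by (intro nn_integral_eq_integral) auto
  have "\<bar>measure N A - measure (density N (\<lambda>x. ennreal (r x))) A\<bar> \<le> B" if A: "A \<in> sets borel" for A
  proof -
    have [measurable]: "A \<in> sets N" using A sets by simp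
    have rA: "integrable N (\<lambda>x. r x * indicator A x)"
      by (rule integrable_real_mult_indicator[OF _ r]) simp
    have "measure (density N (\<lambda>x. ennreal (r x))) A = (\<integral>x. r x * indicator A x \<partial>N)"
    proof -
      have "emeasure (density N (\<lambda>x. ennreal (r x))) A = (\<integral>\<^sup>+x. ennreal (r x * indicator A x) \<partial>N)"
        using r by (subst emeasure_density) (auto intro!: nn_integral_cong simp: indicator_def)
      also have "\<dots> = ennreal (\<integral>x. r x * indicator A x \<partial>N)"
        using rA nonneg by (intro nn_integral_eq_integral) auto
      finally show ?thesis
        using nonneg by (simp add: measure_def)
    qed
    moreover have "measure N A = (\<integral>x. indicator A x \<partial>N)" by simp
    ultimately have "measure N A - measure (density N (\<lambda>x. ennreal (r x))) A
        = (\<integral>x. indicator A x - r x * indicator A x \<partial>N)"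
      using rA by (subst Bochner_Integration.integral_diff) (simp_all add: emeasure_eq_measure)
    also have "\<bar>\<dots>\<bar> \<le> (\<integral>x. \<bar>indicator A x - r x * indicator A x\<bar> \<partial>N)"
      by (rule integral_abs_bound)
    also have "\<dots> \<le> B"
      unfolding B_def
    proof (rule integral_mono)
      have "integrable N (indicator A :: real \<Rightarrow> real)"
        by (simp add: emeasure_eq_measure)
      then show "integrable N (\<lambda>x. \<bar>indicator A x - r x * indicator A x\<bar>)"
        using rA by (intro integrable_abs Bochner_Integration.integrable_diff)
    qed (use r in \<open>auto simp: indicator_def\<close>)
    finally show ?thesis .
  qed
  then have "dTV N (density N (\<lambda>x. ennreal (r x))) \<le> B"
    unfolding dTV_def by (intro cSUP_least) auto
  then show ?thesis
    unfolding B by (rule ennreal_leI)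
qed

section \<open>Densities and distribution functions\<close>

text \<open>Only continuity is asked for at \<open>0\<close>, since a density on \<open>(0, \<infinity>)\<close> may be unbounded there.\<close>

lemma density_of_cdf:
  fixes h H :: "real \<Rightarrow> real"
  assumes [measurable]: "h \<in> borel_measurable borel"
    and nonneg: "\<And>x. 0 < x \<Longrightarrow> 0 \<le> h x"
    and deriv: "\<And>x. 0 < x \<Longrightarrow> (H has_real_derivative h x) (at x)"
    and cont: "continuous_on {0..} H" and zero: "H 0 = 0" and lim: "(H \<longlongrightarrow> 1) at_top"
  defines "N \<equiv> density lborel (\<lambda>x. ennreal (if 0 < x then h x else 0))"
  shows emeasure_density_of_cdf: "\<And>t. 0 \<le> t \<Longrightarrow> emeasure N {..t} = ennreal (H t)"
    and prob_space_density_of_cdf: "prob_space N"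
proof -
  show 1: "emeasure N {..t} = ennreal (H t)" if "0 \<le> t" for t
  proof -
    \<comment> \<open>The fundamental theorem yields a gauge integral; since \<open>h\<close> is
      nonnegative on the open half-line, it also computes the Lebesgue integral, without
      integrability being known beforehand.\<close>
    have "(h has_integral (H t - H 0)) {0..t}"
      using that deriv cont
      by (intro fundamental_theorem_of_calculus_interior)
         (auto simp: has_real_derivative_iff_has_vector_derivative intro: continuous_on_subset)
    then have "(h has_integral H t) {0<..<t}"
      by (simp add: zero has_integral_Icc_iff_Ioo)
    then have hi: "((\<lambda>x. if x \<in> {0<..<t} then h x else 0) has_integral H t) UNIV"
      by (simp only: has_integral_restrict_UNIV)
    have "emeasure N {..t} = (\<integral>\<^sup>+x. ennreal (if x \<in> {0<..<t} then h x else 0) \<partial>lborel)"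
      unfolding N_def using AE_lborel_singleton[of t]
      by (subst emeasure_density) (auto intro!: nn_integral_cong_AE simp: indicator_def elim!: AE_mp)
    also have "\<dots> = ennreal (H t)"
      by (rule nn_integral_has_integral_lborel[OF _ _ hi]) (auto intro: nonneg)
    finally show ?thesis .
  qed
  have sets: "sets N = sets borel" by (simp add: N_def)
  have "(\<lambda>n. emeasure N {..real n}) \<longlonglongrightarrow> emeasure N (\<Union>n. {..real n})"
    by (intro Lim_emeasure_incseq) (auto simp: sets incseq_def)
  also have "(\<Union>n. {..real n}) = space N"
    by (auto simp: N_def intro: real_arch_simple)
  finally have "(\<lambda>n. ennreal (H (real n))) \<longlonglongrightarrow> emeasure N (space N)" by (simp add: 1)
  moreover have "(\<lambda>n. ennreal (H (real n))) \<longlonglongrightarrow> ennreal 1"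
    by (intro tendsto_ennrealI filterlim_compose[OF lim filterlim_real_sequentially])
  ultimately show "prob_space N"
    by (intro prob_spaceI) (auto dest: LIMSEQ_unique)
qed

text \<open>On the interval the cdf is a constant plus the integral of \<open>p\<close> from
  \<open>a\<close>. Starting at \<open>a\<close> keeps the requirement on \<open>p\<close> local, as
  a density on the half-line may be unbounded near 0.\<close>

lemma cdf_density_has_real_derivative:
  fixes D :: "real measure" and p :: "real \<Rightarrow> real"
  assumes "prob_space D" and D: "D = density lborel (\<lambda>x. ennreal (p x))"
    and [measurable]: "p \<in> borel_measurable borel" and nonneg: "\<And>x. 0 \<le> p x"
    and cont: "continuous_on {a..b} p" and x: "a < x" "x < b"
  shows "(cdf D has_real_derivative p x) (at x)"
proof -
  interpret prob_space D by fact
  interpret finite_borel_measure D by standard (simp add: D)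
  have eq: "cdf D a + integral {a..y} p = cdf D y" if y: "a < y" "y < b" for y
  proof -
    have "continuous_on {a..y} p" using cont y by (auto intro: continuous_on_subset)
    then have "(p has_integral integral {a..y} p) {a..y}"
      by (intro integrable_integral integrable_continuous_interval)
    then have hi: "((\<lambda>x. if x \<in> {a..y} then p x else 0) has_integral integral {a..y} p) UNIV"
      by (simp only: has_integral_restrict_UNIV)
    have "emeasure D {a<..y} = (\<integral>\<^sup>+x. ennreal (if x \<in> {a..y} then p x else 0) \<partial>lborel)"
      unfolding D using AE_lborel_singleton[of a]
      by (subst emeasure_density) (auto intro!: nn_integral_cong_AE simp: indicator_def elim!: AE_mp)
    also have "\<dots> = ennreal (integral {a..y} p)"
      by (rule nn_integral_has_integral_lborel[OF _ _ hi]) (auto intro: nonneg)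
    finally have "measure D {a<..y} = integral {a..y} p"
      by (simp add: measure_def Henstock_Kurzweil_Integration.integral_nonneg integral_nonneg nonneg
          integrable_continuous_interval[OF \<open>continuous_on {a..y} p\<close>])
    then show ?thesis using cdf_diff_eq[of a y] y by simp
  qed
  have "((\<lambda>y. integral {a..y} p) has_real_derivative p x) (at x within {a..b})"
    using cont x by (intro integral_has_real_derivative) auto
  then have "((\<lambda>y. integral {a..y} p) has_real_derivative p x) (at x)"
    using x by (simp add: at_within_Icc_at)
  then have "((\<lambda>y. cdf D a + integral {a..y} p) has_real_derivative p x) (at x)"
    by (auto intro!: derivative_eq_intros)
  then show ?thesis
    by (rule has_field_derivative_transform_within_open[of _ _ _ "{a<..<b}"]) (use x eq in auto)
qed

section \<open>The Poisson-exponential distribution\<close>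

text \<open>The cdf is explicit. With \<open>s = \<theta> * exp (- l * t)\<close> it is at most
  \<open>exp (- s)\<close>, its complement is at most \<open>s / (1 - exp (- \<theta>))\<close>, and
  the product of these bounds is exactly \<open>q t / l\<close>.\<close>

lemma poisson_exponential_facts:
  fixes \<theta> l :: real
  assumes [arith]: "0 < \<theta>" "0 < l"
  defines "q \<equiv> \<lambda>w. \<theta> * l * exp (- l * w - \<theta> * exp (- l * w)) / (1 - exp (- \<theta>))"
  shows prob_space_poisson_exponential: "prob_space (poisson_exponential \<theta> l)"
    and poisson_exponential_tails: "\<And>t. 0 < t \<Longrightarrow>
      emeasure (poisson_exponential \<theta> l) {..t} * emeasure (poisson_exponential \<theta> l) {t..} \<le> ennreal (q t / l)"
proof -
  define Q where "Q t = (exp (- \<theta> * exp (- l * t)) - exp (- \<theta>)) / (1 - exp (- \<theta>))" for t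
  let ?N = "poisson_exponential \<theta> l"
  have D: "0 < 1 - exp (- \<theta>)" by simp
  have qnn: "0 \<le> q w" for w unfolding q_def by simp
  have qm: "q \<in> borel_measurable borel" unfolding q_def by measurable
  have N: "?N = density lborel (\<lambda>x. ennreal (if 0 < x then q x else 0))"
    unfolding poisson_exponential_def q_def ..
  have der: "(Q has_real_derivative q t) (at t)" for t
  proof -
    have "- l * t - \<theta> * exp (- l * t) = - l * t + - \<theta> * exp (- l * t)" by simp
    then have e: "exp (- l * t - \<theta> * exp (- l * t)) = exp (- l * t) * exp (- \<theta> * exp (- l * t))"
      by (simp only: exp_add)
    show ?thesis
      unfolding Q_def q_def e using D by (auto intro!: derivative_eq_intros)
  qed
  have cont: "continuous_on {0..} Q"
    using der by (intro continuous_at_imp_continuous_on) (auto intro: DERIV_isCont)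
  have Q0: "Q 0 = 0" by (simp add: Q_def)
  have "((\<lambda>t. exp (- l * t)) \<longlongrightarrow> 0) at_top"
    by real_asymp
  then have "(Q \<longlongrightarrow> (exp (- \<theta> * 0) - exp (- \<theta>)) / (1 - exp (- \<theta>))) at_top"
    unfolding Q_def using D by (intro tendsto_intros) auto
  then have lim: "(Q \<longlongrightarrow> 1) at_top"
    using D by simp
  show prob: "prob_space ?N"
    unfolding N by (rule prob_space_density_of_cdf[OF qm _ der cont Q0 lim]) (simp add: qnn)
  interpret prob_space ?N by fact
  fix t :: real assume t: "0 < t"
  have e1: "emeasure ?N {..t} = ennreal (Q t)"
    unfolding N by (rule emeasure_density_of_cdf[OF qm _ der cont Q0 lim]) (use t in \<open>auto simp: qnn\<close>)
  have Q1: "0 \<le> Q t" "Q t \<le> 1"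
  proof -
    have "exp (- l * t) \<le> 1" using t by simp
    then have "\<theta> * exp (- l * t) \<le> \<theta> * 1" by (intro mult_left_mono) auto
    then show "0 \<le> Q t" "Q t \<le> 1" unfolding Q_def using D by (auto simp: divide_simps)
  qed
  \<comment> \<open>The law has no atom at \<open>t\<close>, so the closed upper tail has mass
    \<open>1 - Q t\<close> although the two tails overlap at \<open>t\<close>.\<close>
  have "emeasure ?N {t} = 0"
    unfolding N by (subst emeasure_density) (use qm in \<open>auto simp: nn_integral_indicator_singleton'\<close>)
  moreover have sets: "sets ?N = sets borel" by (simp add: N)
  moreover have "emeasure ?N {..<t} = emeasure ?N {..t}"
  proof -
    have "{..t} = {..<t} \<union> {t}" by auto
    then show ?thesis
      using calculation emeasure_Un_null_set[of "{..<t}" ?N "{t}"]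
      by (simp add: null_sets_def)
  qed
  ultimately have "measure ?N {..<t} = Q t" using e1 Q1 by (simp add: measure_def)
  then have "measure ?N {t..} = 1 - Q t"
    using prob_compl[of "{..<t}"] sets_eq_imp_space_eq[OF sets] sets by (simp add: Compl_eq_Diff_UNIV[symmetric])
  then have e2: "emeasure ?N {t..} = ennreal (1 - Q t)" by (simp add: emeasure_eq_measure)
  have "Q t * (1 - Q t) \<le> q t / l"
  proof -
    define s where "s = \<theta> * exp (- l * t)"
    have s: "0 < s" unfolding s_def by simp
    have qs: "q t / l = s * exp (- s) / (1 - exp (- \<theta>))"
    proof -
      have "- l * t - s = - l * t + - s" by simp
      then have "exp (- l * t - s) = exp (- l * t) * exp (- s)" by (simp only: exp_add)
      then show ?thesis unfolding q_def s_def[symmetric] by (simp add: s_def)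
    qed
    have "1 - Q t = (1 - exp (- s)) / (1 - exp (- \<theta>))"
      unfolding Q_def s_def using D by (simp add: field_simps)
    moreover have "1 - exp (- s) \<le> s" using exp_ge_add_one_self[of "- s"] by simp
    ultimately have 1: "1 - Q t \<le> s / (1 - exp (- \<theta>))" using D by (simp add: divide_right_mono)
    have "Q t \<le> exp (- s)"
    proof -
      have "exp (- s) * exp (- \<theta>) \<le> 1 * exp (- \<theta>)" using s by (intro mult_right_mono) auto
      then show ?thesis unfolding Q_def s_def[symmetric] using D by (simp add: divide_simps s_def algebra_simps)
    qed
    then have "Q t * (1 - Q t) \<le> exp (- s) * (s / (1 - exp (- \<theta>)))"
      using 1 Q1 s D by (intro mult_mono) auto
    then show ?thesis unfolding qs by (simp add: mult_ac)
  qed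
  moreover have "emeasure ?N {..t} * emeasure ?N {t..} = ennreal (Q t * (1 - Q t))"
    unfolding e1 e2 using Q1 by (intro ennreal_mult[symmetric]) auto
  ultimately show "emeasure ?N {..t} * emeasure ?N {t..} \<le> ennreal (q t / l)"
    by (simp only: ennreal_leI)
qed

text \<open>The Poincare inequality is applied to \<open>r = f / q\<close>, whose mean under the
  target law is 1. As \<open>\<theta> * l * exp (- l * x) - l\<close> is the score of
  \<open>q\<close>, the quotient rule gives \<open>r'\<close> as the expression inside the absolute
  value divided by \<open>q\<close>, and the weight \<open>q / l\<close> cancels that
  division.\<close>

lemma dTV_poisson_exponential_le:
  fixes f f' :: "real \<Rightarrow> real"
  assumes pos: "0 < \<theta>" "0 < l" and [measurable]: "f \<in> borel_measurable borel"
    and nonneg: "\<And>x. 0 < x \<Longrightarrow> 0 \<le> f x"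
    and deriv: "\<And>x. 0 < x \<Longrightarrow> (f has_real_derivative f' x) (at x)"
  defines "D \<equiv> density lborel (\<lambda>x. ennreal (if 0 < x then f x else 0))"
  assumes D: "prob_space D"
  shows "ennreal (dTV (poisson_exponential \<theta> l) D) \<le> ennreal (2 / l) *
    (\<integral>\<^sup>+x. ennreal (if 0 < x then \<bar>f' x - (\<theta> * l * exp (- l * x) - l) * f x\<bar> else 0) \<partial>lborel)"
proof -
  define q where "q = (\<lambda>w. \<theta> * l * exp (- l * w - \<theta> * exp (- l * w)) / (1 - exp (- \<theta>)))"
  let ?N = "poisson_exponential \<theta> l"
  interpret prob_space ?N using pos by (rule prob_space_poisson_exponential)
  interpret D: prob_space D by fact
  have q: "0 < q w" for w unfolding q_def using pos by simp
  have qm[measurable]: "q \<in> borel_measurable borel" unfolding q_def by measurable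
  have N: "?N = density lborel (\<lambda>x. ennreal (if 0 < x then q x else 0))"
    unfolding poisson_exponential_def q_def ..
  have sets: "sets ?N = sets borel" by (simp add: N)
  have dq: "(q has_real_derivative (\<theta> * l * exp (- l * x) - l) * q x) (at x)" for x
  proof -
    define c where "c = \<theta> * l / (1 - exp (- \<theta>))"
    have "q = (\<lambda>w. c * exp (- l * w - \<theta> * exp (- l * w)))"
      by (simp add: q_def c_def)
    then show ?thesis
      by (auto intro!: derivative_eq_intros simp: algebra_simps)
  qed
  \<comment> \<open>The value 0 off the half-line makes \<open>r\<close> nonnegative everywhere; the
    sign of \<open>f\<close> is known only for positive arguments.\<close>
  define r where "r = (\<lambda>x. if 0 < x then f x / q x else 0)"
  define r' where "r' = (\<lambda>x. (f' x - (\<theta> * l * exp (- l * x) - l) * f x) / q x)"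
  have [measurable]: "r \<in> borel_measurable borel" unfolding r_def by measurable
  have rnn: "0 \<le> r x" for x unfolding r_def using nonneg q[of x] by (simp add: less_imp_le)
  have dr: "(r has_real_derivative r' x) (at x)" if x: "0 < x" for x
  proof -
    have "((\<lambda>x. f x / q x) has_real_derivative r' x) (at x)"
      unfolding r'_def using q[of x]
      by (auto intro!: derivative_eq_intros deriv[OF x] dq simp: field_simps)
    then show ?thesis
      by (rule has_field_derivative_transform_within_open[of _ _ _ "{0<..}"]) (use x in \<open>auto simp: r_def\<close>)
  qed
  have DN: "D = density ?N (\<lambda>x. ennreal (r x))"
    unfolding N D_def using q
    by (subst density_density_eq)
       (auto intro!: density_cong simp: r_def nonneg less_imp_le ennreal_mult[symmetric] less_imp_neq[THEN not_sym])
  have nn1: "(\<integral>\<^sup>+x. ennreal (r x) \<partial>?N) = 1"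
  proof -
    have "emeasure D (space ?N) = (\<integral>\<^sup>+x. ennreal (r x) * indicator (space ?N) x \<partial>?N)"
      unfolding DN by (rule emeasure_density[OF _ sets.top]) (simp add: sets cong: measurable_cong_sets)
    also have "\<dots> = (\<integral>\<^sup>+x. ennreal (r x) \<partial>?N)"
      by (intro nn_integral_cong) simp
    finally show ?thesis
      using D.emeasure_space_1 by (simp add: DN)
  qed
  have ri: "integrable ?N r" and r1: "(\<integral>x. r x \<partial>?N) = 1"
    using nn_integral_eq_integrable[of r ?N 1] nn1 rnn by (auto simp: sets cong: measurable_cong_sets)
  have AEpos: "AE x in ?N. 0 < x"
    unfolding N by (subst AE_density) auto
  have "ennreal (dTV ?N D) \<le> (\<integral>\<^sup>+x. ennreal \<bar>r x - (\<integral>x. r x \<partial>?N)\<bar> \<partial>?N)"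
    unfolding r1 DN by (rule dTV_density_le[OF prob_space_axioms sets ri rnn])
  also have "\<dots> \<le> 2 * (\<integral>\<^sup>+t. (if 0 < t then ennreal \<bar>r' t\<bar> * (emeasure ?N {..t} * emeasure ?N {t..}) else 0) \<partial>lborel)"
    by (rule nn_integral_abs_diff_expectation_le[OF prob_space_axioms sets AEpos ri dr])
  also have "\<dots> \<le> 2 * (\<integral>\<^sup>+t. ennreal (1 / l) *
      ennreal (if 0 < t then \<bar>f' t - (\<theta> * l * exp (- l * t) - l) * f t\<bar> else 0) \<partial>lborel)"
  proof (intro mult_left_mono nn_integral_mono)
    fix t
    have "ennreal \<bar>r' t\<bar> * (emeasure ?N {..t} * emeasure ?N {t..})
        \<le> ennreal \<bar>r' t\<bar> * ennreal (q t / l)" if "0 < t"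
      using poisson_exponential_tails[OF pos that] unfolding q_def by (intro mult_left_mono) auto
    also have "ennreal \<bar>r' t\<bar> * ennreal (q t / l)
        = ennreal (1 / l) * ennreal \<bar>f' t - (\<theta> * l * exp (- l * t) - l) * f t\<bar>"
      using q[of t] pos by (simp add: r'_def ennreal_mult[symmetric] abs_divide)
    finally show "(if 0 < t then ennreal \<bar>r' t\<bar> * (emeasure ?N {..t} * emeasure ?N {t..}) else 0)
      \<le> ennreal (1 / l) * ennreal (if 0 < t then \<bar>f' t - (\<theta> * l * exp (- l * t) - l) * f t\<bar> else 0)"
      by simp
  qed simp
  also have "\<dots> = ennreal (2 / l) *
    (\<integral>\<^sup>+x. ennreal (if 0 < x then \<bar>f' x - (\<theta> * l * exp (- l * x) - l) * f x\<bar> else 0) \<partial>lborel)"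
  proof -
    \<comment> \<open>\<open>f'\<close> is constrained only on the half-line, so measurability is
      derived for its cut-off version; it is required for taking the constant out of the
      integral.\<close>
    have "(\<lambda>x. if x \<in> {0<..} then f' x else 0) \<in> borel_measurable borel"
      by (rule borel_measurable_derivative[of f]) (auto intro: deriv)
    then have "(\<lambda>x. if 0 < x then \<bar>(if x \<in> {0<..} then f' x else 0)
        - (\<theta> * l * exp (- l * x) - l) * f x\<bar> else 0) \<in> borel_measurable borel"
      by measurable
    also have "(\<lambda>x. if 0 < x then \<bar>(if x \<in> {0<..} then f' x else 0)
        - (\<theta> * l * exp (- l * x) - l) * f x\<bar> else 0)
        = (\<lambda>x. if 0 < x then \<bar>f' x - (\<theta> * l * exp (- l * x) - l) * f x\<bar> else 0)"
      by auto
    finally have [measurable]: "\<dots> \<in> borel_measurable borel" .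
    have "ennreal (2 / l) = ennreal 2 * ennreal (1 / l)"
      using pos by (subst ennreal_mult[symmetric]) auto
    then show ?thesis by (subst nn_integral_cmult) (simp_all add: mult.assoc)
  qed
  finally show ?thesis .
qed

section \<open>Probability generating functions\<close>

text \<open>The push-forward of \<open>\<mu>\<close> under \<open>M\<close> has the point masses as
  density against counting measure, which turns the expectation into a series.\<close>

lemma nat_expectation_sums:
  fixes f :: "nat \<Rightarrow> real"
  assumes "prob_space \<mu>" and M[measurable]: "M \<in> measurable \<mu> (count_space UNIV)"
    and int: "integrable \<mu> (\<lambda>\<omega>. f (M \<omega>))"
  shows "(\<lambda>n. measure \<mu> (M -` {n} \<inter> space \<mu>) * f n) sums (\<integral>\<omega>. f (M \<omega>) \<partial>\<mu>)"
proof -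
  interpret prob_space \<mu> by fact
  let ?a = "\<lambda>n. measure \<mu> (M -` {n} \<inter> space \<mu>)"
  have eq: "distr \<mu> (count_space UNIV) M = density (count_space UNIV) (\<lambda>n. ennreal (?a n))"
    by (rule measure_eqI_countable[where A = UNIV])
       (auto simp: emeasure_distr emeasure_density emeasure_eq_measure nn_integral_count_space_indicator)
  have "integrable (distr \<mu> (count_space UNIV) M) f"
    using int by (simp add: integrable_distr_eq)
  then have "integrable (count_space UNIV) (\<lambda>n. ?a n * f n)"
    unfolding eq by (subst (asm) integrable_density) auto
  moreover have "(\<integral>\<omega>. f (M \<omega>) \<partial>\<mu>) = (\<integral>n. ?a n * f n \<partial>count_space UNIV)"
  proof -
    have "(\<integral>\<omega>. f (M \<omega>) \<partial>\<mu>) = (\<integral>n. f n \<partial>distr \<mu> (count_space UNIV) M)"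
      by (simp add: integral_distr)
    also have "\<dots> = (\<integral>n. ?a n * f n \<partial>count_space UNIV)"
      unfolding eq by (subst integral_density) auto
    finally show ?thesis .
  qed
  ultimately show ?thesis
    using sums_integral_count_space_nat by simp
qed

lemma pgf_sums:
  assumes "prob_space \<mu>" and M[measurable]: "M \<in> measurable \<mu> (count_space UNIV)" and "\<bar>u\<bar> \<le> 1"
  shows "(\<lambda>n. measure \<mu> (M -` {n} \<inter> space \<mu>) * u ^ n) sums pgf \<mu> M u"
proof -
  interpret prob_space \<mu> by fact
  have "integrable \<mu> (\<lambda>\<omega>. u ^ M \<omega>)"
    using \<open>\<bar>u\<bar> \<le> 1\<close> by (intro integrable_const_bound[where B = 1]) (auto simp: power_abs power_le_one)
  then show ?thesis
    unfolding pgf_def by (rule nat_expectation_sums[OF assms(1) M])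
qed

text \<open>Termwise \<open>\<bar>u ^ n - v ^ n\<bar> \<le> n * \<bar>u - v\<bar>\<close>. The
  estimate includes the endpoint 1, where \<open>pgf\<close> need not be differentiable from both
  sides.\<close>

lemma pgf_lipschitz:
  assumes "prob_space \<mu>" and M[measurable]: "M \<in> measurable \<mu> (count_space UNIV)"
    and int: "integrable \<mu> (\<lambda>\<omega>. real (M \<omega>))" and u: "\<bar>u\<bar> \<le> 1" "\<bar>v\<bar> \<le> 1"
  shows "\<bar>pgf \<mu> M u - pgf \<mu> M v\<bar> \<le> (\<integral>\<omega>. real (M \<omega>) \<partial>\<mu>) * \<bar>u - v\<bar>"
proof -
  interpret prob_space \<mu> by fact
  have i: "integrable \<mu> (\<lambda>\<omega>. w ^ M \<omega>)" if "\<bar>w\<bar> \<le> 1" for w :: real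
    using that by (intro integrable_const_bound[where B = 1]) (auto simp: power_abs power_le_one)
  have "pgf \<mu> M u - pgf \<mu> M v = (\<integral>\<omega>. u ^ M \<omega> - v ^ M \<omega> \<partial>\<mu>)"
    unfolding pgf_def using i u by simp
  also have "\<bar>\<dots>\<bar> \<le> (\<integral>\<omega>. \<bar>u ^ M \<omega> - v ^ M \<omega>\<bar> \<partial>\<mu>)"
    by (rule integral_abs_bound)
  also have "\<dots> \<le> (\<integral>\<omega>. real (M \<omega>) * \<bar>u - v\<bar> \<partial>\<mu>)"
    using i u int norm_power_diff[of u v] by (intro integral_mono) auto
  finally show ?thesis using int by simp
qed

text \<open>The power series converges at 1, so it may be differentiated termwise inside the unit
  interval; \<open>diffs a\<close> is the coefficient sequence of the formal derivative.\<close>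

lemma pgf_derivatives:
  fixes \<mu> :: "'a measure"
  assumes "prob_space \<mu>" and M[measurable]: "M \<in> measurable \<mu> (count_space UNIV)" and u: "\<bar>u\<bar> < 1"
  defines "a \<equiv> \<lambda>n. measure \<mu> (M -` {n} \<inter> space \<mu>)"
  shows has_derivative_pgf: "(pgf \<mu> M has_real_derivative (\<Sum>n. diffs a n * u ^ n)) (at u)"
    and has_derivative_pgf':
      "((\<lambda>u. \<Sum>n. diffs a n * u ^ n) has_real_derivative (\<Sum>n. diffs (diffs a) n * u ^ n)) (at u)"
    and deriv_deriv_pgf: "deriv (deriv (pgf \<mu> M)) u = (\<Sum>n. diffs (diffs a) n * u ^ n)"
proof -
  have sum: "summable (\<lambda>n. a n * v ^ n)" "pgf \<mu> M v = (\<Sum>n. a n * v ^ n)" if "\<bar>v\<bar> \<le> 1" for v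
    using pgf_sums[OF assms(1) M that] unfolding a_def by (auto simp: sums_iff)
  have der: "(pgf \<mu> M has_real_derivative (\<Sum>n. diffs a n * v ^ n)) (at v)" if "\<bar>v\<bar> < 1" for v
  proof -
    have "((\<lambda>v. \<Sum>n. a n * v ^ n) has_real_derivative (\<Sum>n. diffs a n * v ^ n)) (at v)"
      using sum(1)[of 1] that by (intro termdiffs_strong[where K = 1]) auto
    then show ?thesis
      by (rule has_field_derivative_transform_within_open[of _ _ _ "{-1<..<1}"])
         (use that sum(2) in auto)
  qed
  show "(pgf \<mu> M has_real_derivative (\<Sum>n. diffs a n * u ^ n)) (at u)" by (rule der[OF u])
  \<comment> \<open>The differentiated series need not converge at 1, so the second differentiation
    uses a radius \<open>K\<close> strictly below 1.\<close>
  obtain K where K: "\<bar>u\<bar> < K" "K < 1" using u dense by blast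
  have "summable (\<lambda>n. diffs a n * K ^ n)"
    using sum(1)[of 1] K by (intro termdiff_converges[where K = 1] summable_norm_comparison_test) 
     (auto intro!: sum(1))
  then show der2: "((\<lambda>u. \<Sum>n. diffs a n * u ^ n) has_real_derivative (\<Sum>n. diffs (diffs a) n * u ^ n)) (at u)"
    using K by (intro termdiffs_strong[where K = K]) auto
  have "\<forall>\<^sub>F v in nhds u. v \<in> {-1<..<1}"
    using u by (intro eventually_nhds_in_open) auto
  then have "\<forall>\<^sub>F v in nhds u. deriv (pgf \<mu> M) v = (\<Sum>n. diffs a n * v ^ n)"
    by eventually_elim (intro DERIV_imp_deriv der, auto)
  then have "deriv (deriv (pgf \<mu> M)) u = deriv (\<lambda>u. \<Sum>n. diffs a n * u ^ n) u"
    by (rule deriv_cong_ev) simp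
  then show "deriv (deriv (pgf \<mu> M)) u = (\<Sum>n. diffs (diffs a) n * u ^ n)"
    using DERIV_imp_deriv[OF der2] by simp
qed

text \<open>The coefficients are nonnegative, and one is positive because the law of
  \<open>M\<close> has total mass 1 and none of it at 0.\<close>

lemma deriv_pgf_pos:
  assumes "prob_space \<mu>" and M[measurable]: "M \<in> measurable \<mu> (count_space UNIV)"
    and pos: "AE \<omega> in \<mu>. 1 \<le> M \<omega>" and u: "0 < u" "u < 1"
  shows "0 < (\<Sum>n. diffs (\<lambda>n. measure \<mu> (M -` {n} \<inter> space \<mu>)) n * u ^ n)" (is "0 < (\<Sum>n. diffs ?a n * _)")
proof -
  interpret prob_space \<mu> by fact
  have "summable (\<lambda>n. ?a n * 1 ^ n)"
    using pgf_sums[OF assms(1) M, of 1] by (auto simp: sums_iff)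
  then have sm: "summable (\<lambda>n. diffs ?a n * u ^ n)"
    using pgf_sums[OF assms(1) M] u by (intro termdiff_converges[where K = 1]) (auto simp: sums_iff)
  have a1: "?a sums 1"
    using pgf_sums[OF assms(1) M, of 1] by (simp add: pgf_def prob_space)
  have "?a 0 = 0"
    using pos by (subst prob_eq_0) (auto elim!: AE_mp)
  then obtain n where n: "0 < ?a (Suc n)"
    using a1 by (metis (no_types, lifting) measure_nonneg not0_implies_Suc order_le_less sums_0 sums_unique2 zero_neq_one)
  have "0 < diffs ?a n * u ^ n" using n u by (simp add: diffs_def)
  then show ?thesis
    using sm u by (subst suminf_pos_iff) (auto simp: diffs_def intro!: exI[of _ n])
qed

text \<open>The series is dominated termwise by its value at 1, which is the expectation of
  \<open>M\<close>.\<close>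

lemma deriv_pgf_bounded:
  assumes "prob_space \<mu>" and M[measurable]: "M \<in> measurable \<mu> (count_space UNIV)"
    and int: "integrable \<mu> (\<lambda>\<omega>. real (M \<omega>))" and u: "0 \<le> u" "u \<le> 1"
  shows "\<bar>\<Sum>n. diffs (\<lambda>n. measure \<mu> (M -` {n} \<inter> space \<mu>)) n * u ^ n\<bar> \<le> (\<integral>\<omega>. real (M \<omega>) \<partial>\<mu>)"
    (is "\<bar>\<Sum>n. diffs ?a n * _\<bar> \<le> _")
proof -
  have s: "(\<lambda>n. ?a n * real n) sums (\<integral>\<omega>. real (M \<omega>) \<partial>\<mu>)"
    by (rule nat_expectation_sums[OF assms(1) M int])
  \<comment> \<open>Passing to \<open>diffs\<close> shifts the index by one; the lost term at
    \<open>n = 0\<close> carries the factor \<open>real 0\<close>.\<close>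
  then have s': "diffs ?a sums (\<integral>\<omega>. real (M \<omega>) \<partial>\<mu>)"
    using sums_Suc_iff[of "\<lambda>n. ?a n * real n"] by (simp add: diffs_def[abs_def] mult_ac)
  have le: "norm (diffs ?a n * u ^ n) \<le> diffs ?a n" for n
    using u by (auto simp: diffs_def abs_mult power_le_one mult_left_le)
  have "norm (\<Sum>n. diffs ?a n * u ^ n) \<le> (\<Sum>n. diffs ?a n)"
    by (rule norm_suminf_le[OF le sums_summable[OF s']])
  also have "\<dots> = (\<integral>\<omega>. real (M \<omega>) \<partial>\<mu>)" by (rule sums_unique[OF s', symmetric])
  finally show ?thesis by simp
qed

text \<open>The difference quotient of the composition is at most \<open>C\<close> times that of
  \<open>F\<close>. This stands in for the chain rule where \<open>G\<close> need not be
  differentiable at \<open>F x\<close>.\<close>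

lemma deriv_compose_lipschitz_zero:
  fixes F G :: "real \<Rightarrow> real"
  assumes "(F has_real_derivative 0) (at x)" and "\<And>y. \<bar>G (F y) - G (F x)\<bar> \<le> C * \<bar>F y - F x\<bar>"
  shows "((\<lambda>y. G (F y)) has_real_derivative 0) (at x)"
proof -
  have "((\<lambda>h. C * \<bar>(F (x + h) - F x) / h\<bar>) \<longlongrightarrow> C * \<bar>0\<bar>) (at 0)"
    using assms(1) unfolding DERIV_def by (intro tendsto_intros)
  then have "((\<lambda>h. (G (F (x + h)) - G (F x)) / h) \<longlongrightarrow> 0) (at 0)"
    by (rule_tac Lim_null_comparison[rotated])
       (auto intro!: always_eventually divide_right_mono assms(2) simp: abs_divide)
  then show ?thesis unfolding DERIV_def .
qed

text \<open>Since \<open>p x = 0\<close>, the difference quotient of the product is that of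
  \<open>p\<close> times a bounded value of \<open>b\<close>, however irregular \<open>b\<close>
  is.\<close>

lemma deriv_mult_bounded_zero:
  fixes p b :: "real \<Rightarrow> real"
  assumes "(p has_real_derivative 0) (at x)" and "p x = 0" and "\<And>y. \<bar>b y\<bar> \<le> C"
  shows "((\<lambda>y. p y * b y) has_real_derivative 0) (at x)"
proof -
  have "((\<lambda>h. \<bar>(p (x + h) - p x) / h\<bar> * C) \<longlongrightarrow> \<bar>0\<bar> * C) (at 0)"
    using assms(1) unfolding DERIV_def by (intro tendsto_intros)
  then have "((\<lambda>h. (p (x + h) * b (x + h) - p x * b x) / h) \<longlongrightarrow> 0) (at 0)"
    by (rule_tac Lim_null_comparison[rotated])
       (auto intro!: always_eventually divide_right_mono mult_left_mono assms simp: abs_divide abs_mult \<open>p x = 0\<close>)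
  then show ?thesis unfolding DERIV_def .
qed

text \<open>On the open interval the generating function is \<open>c * (exp (t * u) - 1)\<close>, so
  the second derivative is \<open>t\<close> times the first.\<close>

lemma zt_poisson_deriv_ratio:
  fixes M :: "'a \<Rightarrow> nat"
  assumes "prob_space \<mu>" and M[measurable]: "M \<in> measurable \<mu> (count_space UNIV)"
    and t: "0 < t" and law: "distr \<mu> (count_space UNIV) M = measure_pmf (zt_poisson_pmf t)"
    and u: "\<bar>u\<bar> < 1"
  shows "deriv (deriv (pgf \<mu> M)) u / deriv (pgf \<mu> M) u = t"
proof -
  interpret prob_space \<mu> by fact
  have ne: "set_pmf (poisson_pmf t) \<inter> {1..} \<noteq> {}" using t by auto
  \<comment> \<open>The Poisson mass at 0 over the probability of the conditioning event.\<close>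
  define c where "c = exp (- t) / (1 - exp (- t))"
  have c: "c \<noteq> 0" using t by (simp add: c_def)
  have mass: "measure (poisson_pmf t) {1..} = 1 - exp (- t)"
  proof -
    have "{1..} = UNIV - {0::nat}" by auto
    then have "measure (poisson_pmf t) {1..} = 1 - measure (poisson_pmf t) {0}"
      using measure_pmf.prob_compl[of "{0}" "poisson_pmf t"] by simp
    then show ?thesis using t by (simp add: measure_pmf_single)
  qed
  have a: "measure \<mu> (M -` {n} \<inter> space \<mu>) = (if n = 0 then 0 else c * (t ^ n / fact n))" for n
  proof -
    have "measure \<mu> (M -` {n} \<inter> space \<mu>) = measure (distr \<mu> (count_space UNIV) M) {n}"
      by (simp add: measure_distr)
    also have "\<dots> = pmf (zt_poisson_pmf t) n"
      unfolding law by (simp add: measure_pmf_single)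
    finally show ?thesis
      unfolding zt_poisson_pmf_def pmf_cond[OF ne] using t mass by (auto simp: c_def mult_ac)
  qed
  have G: "pgf \<mu> M v = c * (exp (t * v) - 1)" if "\<bar>v\<bar> < 1" for v
  proof -
    have "(\<lambda>n. c * ((t * v) ^ n /\<^sub>R fact n - (if n = 0 then 1 else 0))) sums (c * (exp (t * v) - 1))"
      by (intro sums_mult sums_diff exp_converges) (rule sums_single)
    moreover have "c * ((t * v) ^ n /\<^sub>R fact n - (if n = 0 then 1 else 0))
      = measure \<mu> (M -` {n} \<inter> space \<mu>) * v ^ n" for n
      unfolding a by (simp add: field_simps power_mult_distrib)
    ultimately show ?thesis
      using pgf_sums[OF assms(1) M, of v] that by (simp add: sums_unique2)
  qed
  have d1: "deriv (pgf \<mu> M) v = c * t * exp (t * v)" if "\<bar>v\<bar> < 1" for v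
  proof -
    have "((\<lambda>v. c * (exp (t * v) - 1)) has_real_derivative c * t * exp (t * v)) (at v)"
      by (auto intro!: derivative_eq_intros)
    then have "(pgf \<mu> M has_real_derivative c * t * exp (t * v)) (at v)"
      by (rule has_field_derivative_transform_within_open[of _ _ _ "{-1<..<1}"]) (use that G in auto)
    then show ?thesis by (rule DERIV_imp_deriv)
  qed
  have "((\<lambda>v. c * t * exp (t * v)) has_real_derivative c * t * t * exp (t * u)) (at u)"
    by (auto intro!: derivative_eq_intros)
  then have "(deriv (pgf \<mu> M) has_real_derivative c * t * t * exp (t * u)) (at u)"
    by (rule has_field_derivative_transform_within_open[of _ _ _ "{-1<..<1}"]) (use u d1 in auto)
  then show ?thesis
    using c t by (simp add: DERIV_imp_deriv d1[OF u])
qed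

section \<open>The maximum of a random number of variables\<close>

lemma measurable_random_max:
  assumes "\<And>i. 1 \<le> i \<Longrightarrow> X i \<in> borel_measurable \<mu>" and "M \<in> measurable \<mu> (count_space UNIV)"
  shows "random_max M X \<in> borel_measurable \<mu>"
proof -
  have "(\<lambda>\<omega>. Max ((\<lambda>i. X i \<omega>) ` {1..n})) \<in> borel_measurable \<mu>" for n
    by (rule borel_measurable_Max) (simp_all add: assms(1))
  from measurable_compose_countable[OF this assms(2)]
  have "(\<lambda>\<omega>. Max ((\<lambda>i. X i \<omega>) ` {1..M \<omega>})) \<in> borel_measurable \<mu>" .
  then show ?thesis by (simp add: random_max_def[abs_def])
qed

text \<open>On \<open>M = n\<close> the maximum is at most \<open>x\<close> exactly when the first
  \<open>n\<close> variables are, which contributes \<open>u ^ n\<close> by independence; summing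
  over \<open>n\<close> gives the power series of the generating function.\<close>

lemma prob_random_max_le:
  fixes X :: "nat \<Rightarrow> 'a \<Rightarrow> real" and M :: "'a \<Rightarrow> nat"
  assumes "prob_space \<mu>"
    and X_indep: "prob_space.indep_vars \<mu> (\<lambda>_. borel) X {1..}"
    and M_X_indep: "indep_elements \<mu> (count_space UNIV) M
          (PiM {1..} (\<lambda>_. borel)) (\<lambda>\<omega>. \<lambda>i\<in>{1..}. X i \<omega>)"
    and M_pos: "AE \<omega> in \<mu>. 1 \<le> M \<omega>"
    and u: "\<And>i. 1 \<le> i \<Longrightarrow> measure \<mu> (X i -` {..x} \<inter> space \<mu>) = u"
  shows "measure \<mu> (random_max M X -` {..x} \<inter> space \<mu>) = pgf \<mu> M u"
proof -
  interpret prob_space \<mu> by fact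
  let ?P = "PiM {1..} (\<lambda>_. borel) :: (nat \<Rightarrow> real) measure"
  let ?X = "\<lambda>\<omega>. \<lambda>i\<in>{1..}. X i \<omega>"
  have M[measurable]: "M \<in> measurable \<mu> (count_space UNIV)"
    and indep: "indep_set (sets (vimage_algebra (space \<mu>) M (count_space UNIV)))
      (sets (vimage_algebra (space \<mu>) ?X ?P))"
    using M_X_indep by (auto simp: indep_elements_def)
  have X: "X i \<in> borel_measurable \<mu>" if "1 \<le> i" for i
    using X_indep that by (auto simp: indep_vars_def)
  have W[measurable]: "random_max M X \<in> borel_measurable \<mu>"
    by (rule measurable_random_max[OF X M])
  let ?A = "\<lambda>n. M -` {n} \<inter> space \<mu>"
  let ?W = "random_max M X -` {..x} \<inter> space \<mu>"
  have prob: "prob (?A n \<inter> ?W) = prob (?A n) * u ^ n" for n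
  proof (cases "n = 0")
    \<comment> \<open>The maximum over the empty set is unspecified, so this event is handled
      through its probability 0.\<close>
    case True
    have "prob (?A 0) = 0"
      using M_pos by (subst prob_eq_0) (auto elim!: AE_mp)
    moreover have "prob (?A 0 \<inter> ?W) \<le> prob (?A 0)" by (intro finite_measure_mono) auto
    ultimately show ?thesis using True measure_nonneg[of \<mu> "?A 0 \<inter> ?W"] by simp
  next
    case False
    let ?E = "\<Inter>i\<in>{1..n}. X i -` {..x} \<inter> space \<mu>"
    let ?S = "\<Inter>i\<in>{1..n}. (\<lambda>f. f i) -` {..x} \<inter> space ?P"
    have S: "?S \<in> sets ?P"
    proof (intro sets.finite_INT)
      show "(\<lambda>f. f i) -` {..x} \<inter> space ?P \<in> sets ?P" if "i \<in> {1..n}" for i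
        using that by (intro measurable_sets[OF measurable_component_singleton[of i]]) auto
    qed (use False in auto)
    \<comment> \<open>\<open>M\<close> is independent of the sequence as a whole, so the event is
      presented as the preimage of a cylinder in the product space.\<close>
    have E: "?E = ?X -` ?S \<inter> space \<mu>"
      using False by (auto simp: space_PiM)
    have "?A n \<inter> ?W = ?A n \<inter> ?E"
      using False by (auto simp: random_max_def)
    also have "prob (?A n \<inter> ?E) = prob (?A n) * prob ?E"
      unfolding E
    proof (rule indep_setD[OF indep])
      show "?A n \<in> sets (vimage_algebra (space \<mu>) M (count_space UNIV))"
        by (rule in_vimage_algebra) simp
      show "?X -` ?S \<inter> space \<mu> \<in> sets (vimage_algebra (space \<mu>) ?X ?P)"
        by (rule in_vimage_algebra[OF S])
    qed
    also have "prob ?E = (\<Prod>i\<in>{1..n}. prob (X i -` {..x} \<inter> space \<mu>))"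
      using False by (intro indep_varsD[OF X_indep]) auto
    also have "\<dots> = u ^ n" by (simp add: u)
    finally show ?thesis .
  qed
  have "(\<lambda>n. prob (?A n \<inter> ?W)) sums prob (\<Union>n. ?A n \<inter> ?W)"
    by (intro finite_measure_UNION) (auto simp: disjoint_family_on_def)
  also have "(\<Union>n. ?A n \<inter> ?W) = ?W" by auto
  finally have "(\<lambda>n. prob (?A n) * u ^ n) sums prob ?W" by (simp add: prob)
  moreover have "(\<lambda>n. prob (?A n) * u ^ n) sums pgf \<mu> M u"
    using u[of 1] by (intro pgf_sums[OF assms(1) M]) auto
  ultimately show ?thesis by (rule sums_unique2)
qed

theorem corollary4p3:
  fixes \<mu> :: "'a measure" and \<theta> l :: real
    and X :: "nat \<Rightarrow> 'a \<Rightarrow> real" and M :: "'a \<Rightarrow> nat"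
    and p F G :: "real \<Rightarrow> real" and W :: "'a \<Rightarrow> real"
  assumes "prob_space \<mu>" and "\<theta> > 0" and "l > 0"
    and X_indep: "prob_space.indep_vars \<mu> (\<lambda>_. borel) X {1..}"
    and X_pos: "\<And>i. i \<ge> 1 \<Longrightarrow> AE \<omega> in \<mu>. X i \<omega> > 0"
    and X_pdf: "\<And>i. i \<ge> 1 \<Longrightarrow> distributed \<mu> lborel (X i) (\<lambda>x. ennreal (p x))"
    and p_nonneg: "\<And>x. p x \<ge> 0"
    and p_diff: "p differentiable_on {0<..}"
    and F_def: "F = cdf (distr \<mu> borel (X 1))"
    and M_pos: "AE \<omega> in \<mu>. M \<omega> \<ge> 1"
    and M_moment: "integrable \<mu> (\<lambda>\<omega>. (real (M \<omega>))\<^sup>2)"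
    and M_X_indep: "indep_elements \<mu> (count_space UNIV) M
          (PiM {1..} (\<lambda>_. borel)) (\<lambda>\<omega>. \<lambda>i\<in>{1..}. X i \<omega>)"
    and G_def: "G = pgf \<mu> M"
    and W_def: "W = random_max M X"
  shows "ennreal (dTV (poisson_exponential \<theta> l) (distr \<mu> borel W))
      \<le> ennreal (4 / l) *
          ((\<integral>\<^sup>+\<omega>. ennreal \<bar>\<theta> * l * exp (- l * W \<omega>)
                - deriv (deriv G) (F (W \<omega>)) / deriv G (F (W \<omega>)) * p (W \<omega>)\<bar> \<partial>\<mu>)
           + (\<integral>\<^sup>+\<omega>. ennreal \<bar>- l - score p (W \<omega>)\<bar> \<partial>\<mu>))
    \<and> (\<forall>\<theta>\<^sub>m>0. distr \<mu> (count_space UNIV) M = measure_pmf (zt_poisson_pmf \<theta>\<^sub>m) \<longrightarrow>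
        ennreal (4 / l) *
          ((\<integral>\<^sup>+\<omega>. ennreal \<bar>\<theta> * l * exp (- l * W \<omega>)
                - deriv (deriv G) (F (W \<omega>)) / deriv G (F (W \<omega>)) * p (W \<omega>)\<bar> \<partial>\<mu>)
           + (\<integral>\<^sup>+\<omega>. ennreal \<bar>- l - score p (W \<omega>)\<bar> \<partial>\<mu>))
        = ennreal (4 / l) *
          ((\<integral>\<^sup>+\<omega>. ennreal \<bar>\<theta> * l * exp (- l * W \<omega>) - \<theta>\<^sub>m * p (W \<omega>)\<bar> \<partial>\<mu>)
           + (\<integral>\<^sup>+\<omega>. ennreal \<bar>- l - score p (W \<omega>)\<bar> \<partial>\<mu>))
      \<and> ennreal (dTV (poisson_exponential \<theta> l) (distr \<mu> borel W))
        \<le> ennreal (4 / l) *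
          ((\<integral>\<^sup>+\<omega>. ennreal \<bar>\<theta> * l * exp (- l * W \<omega>) - \<theta>\<^sub>m * p (W \<omega>)\<bar> \<partial>\<mu>)
           + (\<integral>\<^sup>+\<omega>. ennreal \<bar>- l - score p (W \<omega>)\<bar> \<partial>\<mu>)))"
proof -
  interpret prob_space \<mu> by fact
  have M[measurable]: "M \<in> measurable \<mu> (count_space UNIV)"
    using M_X_indep by (simp add: indep_elements_def)
  have X: "X i \<in> borel_measurable \<mu>" if "1 \<le> i" for i
    using X_indep that by (auto simp: indep_vars_def)
  have W[measurable]: "W \<in> borel_measurable \<mu>"
    unfolding W_def by (rule measurable_random_max[OF X M])
  have M_int: "integrable \<mu> (\<lambda>\<omega>. real (M \<omega>))"
  proof (rule Bochner_Integration.integrable_bound[OF M_moment])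
    show "AE \<omega> in \<mu>. norm (real (M \<omega>)) \<le> norm ((real (M \<omega>))\<^sup>2)"
      by (auto simp: power2_eq_square simp flip: of_nat_mult)
  qed simp
  define C where "C = (\<integral>\<omega>. real (M \<omega>) \<partial>\<mu>)"
  define a where "a = (\<lambda>n. measure \<mu> (M -` {n} \<inter> space \<mu>))"
  \<comment> \<open>These series agree with \<open>deriv G\<close> and
    \<open>deriv (deriv G)\<close> on \<open>(-1, 1)\<close> and are Borel functions on the whole
    line.\<close>
  define g where "g = (\<lambda>u. \<Sum>n. diffs a n * u ^ n)"
  define g' where "g' = (\<lambda>u. \<Sum>n. diffs (diffs a) n * u ^ n)"
  have [measurable]: "g \<in> borel_measurable borel" "g' \<in> borel_measurable borel"
    unfolding g_def g'_def by measurable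

  \<comment> \<open>The common law of the variables\<close>
  define D where "D = distr \<mu> borel (X 1)"
  have D_eq: "distr \<mu> borel (X i) = density lborel (\<lambda>x. ennreal (p x))" if "1 \<le> i" for i
    using distributed_distr_eq_density[OF X_pdf[OF that]] by (simp cong: distr_cong)
  have "(\<lambda>x. ennreal (p x)) \<in> borel_measurable lborel"
    using X_pdf[of 1] by (simp add: distributed_def)
  then have "(\<lambda>x. enn2real (ennreal (p x))) \<in> borel_measurable borel" by measurable
  then have pm[measurable]: "p \<in> borel_measurable borel" by (simp add: p_nonneg)
  have DX: "D = density lborel (\<lambda>x. ennreal (p x))"
    using D_eq[of 1] by (simp add: D_def)
  have D: "prob_space D"
    unfolding D_def by (rule prob_space_distr) (simp add: X)
  interpret D: prob_space D by fact
  interpret D: real_distribution D by standard (simp_all add: D_def)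
  have Fcdf: "F = cdf D" by (simp add: F_def D_def)
  have Fm[measurable]: "F \<in> borel_measurable borel"
    unfolding Fcdf by (intro borel_measurable_mono monoI D.cdf_nondecreasing)
  have F01: "0 \<le> F x" "F x \<le> 1" for x
    unfolding Fcdf by (simp_all add: D.cdf_nonneg D.cdf_bounded_prob)
  have F_X: "measure \<mu> (X i -` {..x} \<inter> space \<mu>) = F x" if "1 \<le> i" for i x
  proof -
    have "measure \<mu> (X i -` {..x} \<inter> space \<mu>) = measure (distr \<mu> borel (X i)) {..x}"
      using X[OF that] by (simp add: measure_distr)
    then show ?thesis
      using D_eq[OF that] by (simp add: Fcdf cdf_def DX)
  qed
  have F0: "F 0 = 0"
  proof -
    have "prob (X 1 -` {..0} \<inter> space \<mu>) = 0"
      using X_pos[of 1] X[of 1] by (subst prob_eq_0) (auto elim!: AE_mp)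
    then show ?thesis using F_X[of 1 0] by simp
  qed
  have dp: "(p has_real_derivative deriv p x) (at x)" if "0 < x" for x
  proof -
    have "p differentiable (at x)"
      using p_diff that by (auto simp: differentiable_on_def at_within_open[of _ "{0<..}"])
    then show ?thesis by (simp add: DERIV_deriv_iff_real_differentiable)
  qed
  have pcont: "continuous_on S p" if "S \<subseteq> {0<..}" for S
    using that dp by (intro continuous_at_imp_continuous_on) (auto intro: DERIV_isCont)
  \<comment> \<open>The interval from \<open>x / 2\<close> to \<open>x + 1\<close> stays away from
    0, where \<open>p\<close> need not be continuous.\<close>
  have dF: "(F has_real_derivative p x) (at x)" if "0 < x" for x
    unfolding Fcdf
    by (rule cdf_density_has_real_derivative[OF D DX pm p_nonneg, of "x / 2" "x + 1"])
       (use that in \<open>auto intro: pcont\<close>)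
  \<comment> \<open>Where \<open>F\<close> attains 0 or 1 it has a global extremum, and its
    derivative \<open>p x\<close> would vanish.\<close>
  have F_interior: "0 < F x" "F x < 1" if "0 < x" "0 < p x" for x
  proof -
    have "F x \<noteq> 0"
      using DERIV_local_min[OF dF[OF that(1)], of 1] F01 that(2) by auto
    moreover have "F x \<noteq> 1"
      using DERIV_local_max[OF dF[OF that(1)], of 1] F01 that(2) by auto
    ultimately show "0 < F x" "F x < 1" using F01[of x] by auto
  qed
  have dp0: "(p has_real_derivative 0) (at x)" if "0 < x" "p x = 0" for x
    using DERIV_local_min[OF dp[OF that(1)], of 1] p_nonneg dp[OF that(1)] that(2) by auto

  \<comment> \<open>Differentiability of the distribution function and density of the
    maximum\<close>
  have dG: "(G has_real_derivative g u) (at u)"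
    and dg: "(g has_real_derivative g' u) (at u)"
    and ddG: "deriv (deriv G) u = g' u" "deriv G u = g u" if "\<bar>u\<bar> < 1" for u
    unfolding g_def g'_def a_def G_def
    using has_derivative_pgf[OF assms(1) M that] has_derivative_pgf'[OF assms(1) M that]
      deriv_deriv_pgf[OF assms(1) M that] by (auto intro: DERIV_imp_deriv)
  have gpos: "0 < g u" if "0 < u" "u < 1" for u
    unfolding g_def a_def by (rule deriv_pgf_pos[OF assms(1) M M_pos that])
  have gC: "\<bar>g (F x)\<bar> \<le> C" for x
    unfolding g_def a_def C_def by (rule deriv_pgf_bounded[OF assms(1) M M_int F01])
  define H where "H = (\<lambda>x. G (F x))"
  define f where "f = (\<lambda>x. p x * g (F x))"
  \<comment> \<open>The case split follows the two arguments below: product and chain rule where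
    \<open>p\<close> is positive, bounded factor where it vanishes.\<close>
  define f' where "f' = (\<lambda>x. if p x = 0 then 0 else deriv p x * g (F x) + p x * (p x * g' (F x)))"
  have [measurable]: "f \<in> borel_measurable borel" unfolding f_def by measurable
  have fnn: "0 \<le> f x" if "0 < x" for x
    using F_interior[OF that] gpos[of "F x"] p_nonneg[of x] by (cases "p x = 0") (auto simp: f_def)
  have dH: "(H has_real_derivative f x) (at x)" if "0 < x" for x
  proof (cases "p x = 0")
    case True
    \<comment> \<open>Here \<open>F x\<close> may be 1, outside the open interval on which
      \<open>G\<close> is known to be differentiable.\<close>
    have "\<bar>G (F y) - G (F x)\<bar> \<le> C * \<bar>F y - F x\<bar>" for y
      unfolding G_def C_def using F01[of x] F01[of y] by (intro pgf_lipschitz[OF assms(1) M M_int]) auto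
    then show ?thesis
      using deriv_compose_lipschitz_zero[of F x G C] dF[OF that] True by (simp add: H_def f_def)
  next
    case False
    then have "\<bar>F x\<bar> < 1" using F_interior[OF that] p_nonneg[of x] by (simp add: less_le)
    from DERIV_chain2[OF dG[OF this] dF[OF that]] show ?thesis
      by (simp add: H_def f_def mult.commute)
  qed
  have df: "(f has_real_derivative f' x) (at x)" if "0 < x" for x
  proof (cases "p x = 0")
    case True
    then show ?thesis
      using deriv_mult_bounded_zero[OF dp0[OF that True] True gC] by (simp add: f_def f'_def)
  next
    case False
    then have "\<bar>F x\<bar> < 1" using F_interior[OF that] p_nonneg[of x] by (simp add: less_le)
    from DERIV_mult[OF dp[OF that] DERIV_chain2[OF dg[OF this] dF[OF that]]] False show ?thesis
      by (simp add: f_def f'_def algebra_simps)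
  qed

  \<comment> \<open>Identification of the law of the maximum\<close>
  define L where "L = distr \<mu> borel W"
  have "prob_space L" unfolding L_def by (rule prob_space_distr) simp
  then interpret L: prob_space L .
  interpret L: real_distribution L by standard (simp_all add: L_def)
  have H_cdf: "cdf L x = H x" for x
  proof -
    have "cdf L x = measure \<mu> (W -` {..x} \<inter> space \<mu>)"
      by (simp add: cdf_def L_def measure_distr)
    also have "\<dots> = H x"
      unfolding W_def H_def G_def
      by (rule prob_random_max_le[OF assms(1) X_indep M_X_indep M_pos F_X])
    finally show ?thesis .
  qed
  have H0: "H 0 = 0"
  proof -
    have "AE \<omega> in \<mu>. (0::real) ^ M \<omega> = 0" using M_pos by eventually_elim simp
    then have "G 0 = (\<integral>\<omega>. 0 \<partial>\<mu>)"
      unfolding G_def pgf_def by (intro integral_cong_AE) auto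
    then show ?thesis by (simp add: H_def F0)
  qed
  have Hlim: "(H \<longlongrightarrow> 1) at_top"
    using L.cdf_lim_at_top_prob by (simp add: H_cdf[abs_def])
  have Hcont: "continuous_on {0..} H"
    unfolding continuous_on_eq_continuous_within
  proof
    fix x :: real assume "x \<in> {0..}"
    then consider "x = 0" | "0 < x" by fastforce
    then show "continuous (at x within {0..}) H"
    proof cases
      case 1
      \<comment> \<open>At 0 no derivative is available; right-continuity of a distribution function
        replaces it.\<close>
      have "continuous (at_right 0) H"
        using L.cdf_is_right_cont[of 0] by (simp add: H_cdf[abs_def])
      then show ?thesis
        using 1 by (simp add: continuous_within at_within_Ici_at_right)
    next
      case 2
      then show ?thesis
        using DERIV_isCont[OF dH] by (auto intro: continuous_at_imp_continuous_at_within)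
    qed
  qed
  define K where "K = density lborel (\<lambda>x. ennreal (if 0 < x then f x else 0))"
  have K: "prob_space K"
    unfolding K_def by (rule prob_space_density_of_cdf[OF _ fnn dH Hcont H0 Hlim]) auto
  then interpret K: prob_space K .
  interpret K: real_distribution K by standard (simp_all add: K_def)
  have K1: "cdf K x = H x" if "0 \<le> x" for x
    using emeasure_density_of_cdf[OF _ fnn dH Hcont H0 Hlim that] H_cdf[of x] L.cdf_nonneg[of x]
    by (simp add: cdf_def K_def measure_def)
  \<comment> \<open>Both distribution functions vanish at 0, hence at negative points by
    monotonicity; elsewhere both equal \<open>H\<close>.\<close>
  have "cdf L = cdf K"
  proof
    fix x show "cdf L x = cdf K x"
    proof (cases "0 \<le> x")
      case False
      then have "cdf L x = 0" "cdf K x = 0"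
        using L.cdf_nondecreasing[of x 0] K.cdf_nondecreasing[of x 0] L.cdf_nonneg[of x] K.cdf_nonneg[of x]
          K1[of 0] H0 H_cdf[of 0] by auto
      then show ?thesis by simp
    qed (simp add: K1 H_cdf)
  qed
  then have LK: "L = K"
    by (intro cdf_unique L.real_distribution_axioms K.real_distribution_axioms)

  \<comment> \<open>The bound and its Poisson case\<close>
  have AE_W: "AE \<omega> in \<mu>. 0 < W \<omega> \<and> 0 < p (W \<omega>)"
  proof -
    \<comment> \<open>\<open>f\<close> contains the factor \<open>p\<close>, so the law does not
      charge the zeros of \<open>p\<close>, and the quotients below meet a zero denominator only on
      a null set.\<close>
    have "AE x in L. 0 < x \<and> 0 < p x"
      unfolding LK K_def using p_nonneg
      by (subst AE_density) (auto simp: f_def less_le split: if_splits)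
    then show ?thesis
      unfolding L_def by (subst (asm) AE_distr_iff) auto
  qed
  \<comment> \<open>Borel versions of the two integrands. At positive points where \<open>p\<close>
    is positive, \<open>\<phi> + \<psi>\<close> is the score of the target density minus that of
    \<open>f\<close>.\<close>
  define \<phi> where "\<phi> = (\<lambda>x. \<theta> * l * exp (- l * x) - g' (F x) / g (F x) * p x)"
  define \<psi> where "\<psi> = (\<lambda>x. - l - (if x \<in> {0<..} then deriv p x else 0) / p x)"
  have "(\<lambda>x. if x \<in> {0<..} then deriv p x else 0) \<in> borel_measurable borel"
    by (rule borel_measurable_derivative[OF pm]) (auto intro: dp)
  then have \<psi>m[measurable]: "\<psi> \<in> borel_measurable borel"
    unfolding \<psi>_def by measurable
  have \<phi>m[measurable]: "\<phi> \<in> borel_measurable borel"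
    unfolding \<phi>_def by measurable
  have score_diff: "\<bar>f' x - (\<theta> * l * exp (- l * x) - l) * f x\<bar> = f x * \<bar>\<phi> x + \<psi> x\<bar>" if "0 < x" for x
  proof (cases "p x = 0")
    case False
    then have "0 < p x" using p_nonneg[of x] by simp
    then have "0 < g (F x)" by (intro gpos F_interior that)
    then have "f' x - (\<theta> * l * exp (- l * x) - l) * f x = - (f x * (\<phi> x + \<psi> x))"
      using False that by (simp add: f_def f'_def \<phi>_def \<psi>_def field_simps)
    then show ?thesis using fnn[OF that] by (simp add: abs_mult)
  qed (simp add: f_def f'_def)
  have "ennreal (dTV (poisson_exponential \<theta> l) L) \<le> ennreal (2 / l) *
    (\<integral>\<^sup>+x. ennreal (if 0 < x then \<bar>f' x - (\<theta> * l * exp (- l * x) - l) * f x\<bar> else 0) \<partial>lborel)"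
    unfolding LK K_def
    by (rule dTV_poisson_exponential_le[OF \<open>0 < \<theta>\<close> \<open>0 < l\<close> _ fnn df]) (use K in \<open>auto simp: K_def\<close>)
  also have "(\<integral>\<^sup>+x. ennreal (if 0 < x then \<bar>f' x - (\<theta> * l * exp (- l * x) - l) * f x\<bar> else 0) \<partial>lborel)
    = (\<integral>\<^sup>+x. ennreal \<bar>\<phi> x + \<psi> x\<bar> \<partial>L)"
    unfolding LK K_def
    by (subst nn_integral_density)
       (auto intro!: nn_integral_cong simp: score_diff[simplified] fnn ennreal_mult)
  also have "\<dots> = (\<integral>\<^sup>+\<omega>. ennreal \<bar>\<phi> (W \<omega>) + \<psi> (W \<omega>)\<bar> \<partial>\<mu>)"
    unfolding L_def by (subst nn_integral_distr) auto
  also have "\<dots> \<le> (\<integral>\<^sup>+\<omega>. ennreal \<bar>\<phi> (W \<omega>)\<bar> + ennreal \<bar>\<psi> (W \<omega>)\<bar> \<partial>\<mu>)"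
    by (intro nn_integral_mono) (simp add: ennreal_leI flip: ennreal_plus)
  also have "\<dots> = (\<integral>\<^sup>+\<omega>. ennreal \<bar>\<phi> (W \<omega>)\<bar> \<partial>\<mu>) + (\<integral>\<^sup>+\<omega>. ennreal \<bar>\<psi> (W \<omega>)\<bar> \<partial>\<mu>)"
    by (rule nn_integral_add) auto
  also have "(\<integral>\<^sup>+\<omega>. ennreal \<bar>\<phi> (W \<omega>)\<bar> \<partial>\<mu>) = (\<integral>\<^sup>+\<omega>. ennreal \<bar>\<theta> * l * exp (- l * W \<omega>)
      - deriv (deriv G) (F (W \<omega>)) / deriv G (F (W \<omega>)) * p (W \<omega>)\<bar> \<partial>\<mu>)" (is "_ = ?I1")
  proof (rule nn_integral_cong_AE)
    show "AE \<omega> in \<mu>. ennreal \<bar>\<phi> (W \<omega>)\<bar> = ennreal \<bar>\<theta> * l * exp (- l * W \<omega>)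
      - deriv (deriv G) (F (W \<omega>)) / deriv G (F (W \<omega>)) * p (W \<omega>)\<bar>"
      using AE_W
    proof eventually_elim
      case (elim \<omega>)
      then have "\<bar>F (W \<omega>)\<bar> < 1" using F_interior[of "W \<omega>"] by simp
      then show ?case by (simp add: \<phi>_def ddG)
    qed
  qed
  also have "(\<integral>\<^sup>+\<omega>. ennreal \<bar>\<psi> (W \<omega>)\<bar> \<partial>\<mu>) = (\<integral>\<^sup>+\<omega>. ennreal \<bar>- l - score p (W \<omega>)\<bar> \<partial>\<mu>)" (is "_ = ?I2")
    using AE_W by (intro nn_integral_cong_AE) (auto simp: \<psi>_def score_def elim!: AE_mp)
  finally have "ennreal (dTV (poisson_exponential \<theta> l) L) \<le> ennreal (2 / l) * (?I1 + ?I2)"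
    by (simp add: mult_left_mono)
  also have "\<dots> \<le> ennreal (4 / l) * (?I1 + ?I2)"
    using \<open>0 < l\<close> by (intro mult_right_mono ennreal_leI) (auto simp: divide_right_mono)
  finally have bound: "ennreal (dTV (poisson_exponential \<theta> l) (distr \<mu> borel W)) \<le> ennreal (4 / l) * (?I1 + ?I2)"
    unfolding L_def .
  have poisson: "?I1 = (\<integral>\<^sup>+\<omega>. ennreal \<bar>\<theta> * l * exp (- l * W \<omega>) - t * p (W \<omega>)\<bar> \<partial>\<mu>)"
    if t: "0 < t" and law: "distr \<mu> (count_space UNIV) M = measure_pmf (zt_poisson_pmf t)" for t
  proof (rule nn_integral_cong_AE)
    show "AE \<omega> in \<mu>. ennreal \<bar>\<theta> * l * exp (- l * W \<omega>)
        - deriv (deriv G) (F (W \<omega>)) / deriv G (F (W \<omega>)) * p (W \<omega>)\<bar>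
      = ennreal \<bar>\<theta> * l * exp (- l * W \<omega>) - t * p (W \<omega>)\<bar>"
      using AE_W
    proof eventually_elim
      case (elim \<omega>)
      then have "\<bar>F (W \<omega>)\<bar> < 1" using F_interior[of "W \<omega>"] by simp
      then show ?case
        unfolding G_def by (simp only: zt_poisson_deriv_ratio[OF assms(1) M t law])
    qed
  qed
  show ?thesis
    using bound poisson by auto
qed

end
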